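(* Let $g>0$ and let $f\in C^4(\mathbb{R})$ be a $1$-periodic function. Then there exists $\alpha_*\in\mathbb{R}$ such that for every $\alpha>\alpha_*$ there exists an orbit $(t_n^*,w_n^* )_{n\in\mathbb{Z}}$ of the bouncing ball map $S$ associated with $f$ and $g$ such that $$\lim_{n\to\infty}\frac{1}{n}\sum_{k=0}^{n-1}(t_{k+1}^*-t_k^* )=\alpha .$$
   Context: The model is a ball of mass $1$ falling under constant gravity $g>0$ and bouncing elastically on a racket whose vertical position at time $t$ is $f(t)$, where $f\in C^4(\mathbb{R})$ is $1$-periodic. For $t_1\neq t_0$ write $f[t_1,t_0]=\frac{f(t_1)-f(t_0)}{t_1-t_0}$. The bouncing ball map $S(t_0,w_0)=(t_1,w_1)$ (impact time and velocity to next impact time and velocity) is defined implicitly by $$t_1=t_0+\frac{2}{g}w_0-\frac{2}{g}f[t_1,t_0]+\frac{2}{g}\dot f(t_0),\qquad w_1=w_0-2f[t_1,t_0]+\dot f(t_1)+\dot f(t_0).$$ There is a constant $\bar w>0$ such that for every $t_0\in\mathbb{R}$ and every $w_0>\bar w$ these equations determine $(t_1,w_1)$ uniquely; fix such a $\bar w$ and regard $S$ as a map defined on $\mathbb{R}\times(\bar w,\infty)$. An orbit of $S$ is a sequence $(t_n,w_n)_{n\in\mathbb{Z}}$ in $\mathbb{R}\times(\bar w,\infty)$ with $S(t_n,w_n)=(t_{n+1},w_{n+1})$ for every $n\in\mathbb{Z}$. *)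

theory Defs
  imports "HOL-Analysis.Analysis" "HOL-Library.Periodic_Fun"
begin

definition C_k :: "nat \<Rightarrow> (real \<Rightarrow> real) \<Rightarrow> bool" where
  "C_k k f \<longleftrightarrow>
     (\<forall>i<k. (deriv ^^ i) f differentiable_on UNIV) \<and> continuous_on UNIV ((deriv ^^ k) f)"

definition divided_difference :: "(real \<Rightarrow> real) \<Rightarrow> real \<Rightarrow> real \<Rightarrow> real" where
  "divided_difference f t1 t0 = (f t1 - f t0) / (t1 - t0)"

text \<open>
  The condition \<open>t1 \<noteq> t0\<close> is the one under which the divided difference is meaningful; without it,
  the convention \<open>x / 0 = 0\<close> could introduce spurious solutions.
\<close>

definition bounce_equations ::
    "real \<Rightarrow> (real \<Rightarrow> real) \<Rightarrow> real \<times> real \<Rightarrow> real \<times> real \<Rightarrow> bool" where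
  "bounce_equations g f = (\<lambda>(t0, w0) (t1, w1).
     t1 \<noteq> t0 \<and>
     t1 = t0 + 2 / g * w0 - 2 / g * divided_difference f t1 t0 + 2 / g * deriv f t0 \<and>
     w1 = w0 - 2 * divided_difference f t1 t0 + deriv f t1 + deriv f t0)"

definition admissible_threshold :: "real \<Rightarrow> (real \<Rightarrow> real) \<Rightarrow> real \<Rightarrow> bool" where
  "admissible_threshold g f wbar \<longleftrightarrow>
     wbar > 0 \<and> (\<forall>t0 w0. w0 > wbar \<longrightarrow> (\<exists>!p. bounce_equations g f (t0, w0) p))"

text \<open>
  The map is only meaningful at points with velocity above an admissible threshold; orbits are
  required to stay there.
\<close>

definition bouncing_ball_map :: "real \<Rightarrow> (real \<Rightarrow> real) \<Rightarrow> real \<times> real \<Rightarrow> real \<times> real" where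
  "bouncing_ball_map g f p = (THE q. bounce_equations g f p q)"

definition bouncing_ball_orbit ::
    "real \<Rightarrow> (real \<Rightarrow> real) \<Rightarrow> real \<Rightarrow> (int \<Rightarrow> real) \<Rightarrow> (int \<Rightarrow> real) \<Rightarrow> bool" where
  "bouncing_ball_orbit g f wbar t w \<longleftrightarrow>
     (\<forall>n. w n > wbar \<and> bouncing_ball_map g f (t n, w n) = (t (n + 1), w (n + 1)))"

text \<open>Admissible thresholds exist, so assuming one is not vacuous.\<close>

lemma admissible_threshold_exists:
  fixes g :: real and f :: "real \<Rightarrow> real"
  assumes g: "g > 0" and C4: "C_k 4 f" and per: "\<And>x. f (x + 1) = f x"
  shows "\<exists>wbar. admissible_threshold g f wbar"
proof -
  have d0: "f differentiable_on UNIV" and d1: "deriv f differentiable_on UNIV"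
    using C4 unfolding C_k_def by (force dest: spec[of _ 0] spec[of _ 1])+
  have D: "(f has_real_derivative deriv f x) (at x)" for x
    using d0 by (simp add: differentiable_on_def DERIV_deriv_iff_real_differentiable)
  have dper: "deriv f (x + 1) = deriv f x" for x
  proof -
    have "((\<lambda>x. f (x + 1)) has_real_derivative deriv f (x + 1)) (at x)"
      using D[of "x + 1"] by (simp add: DERIV_shift)
    then show ?thesis
      using D[of x] per DERIV_unique by simp blast
  qed
  interpret periodic_fun_simple' "deriv f"
    by unfold_locales (rule dper)
  have "compact (deriv f ` {0..1})"
    using differentiable_imp_continuous_on[OF d1]
    by (intro compact_continuous_image) (auto intro: continuous_on_subset)
  then obtain M where M: "\<And>x. x \<in> {0..1} \<Longrightarrow> \<bar>deriv f x\<bar> \<le> M"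
    using bounded_iff[of "deriv f ` {0..1}"] compact_imp_bounded by force
  have B: "\<bar>deriv f x\<bar> \<le> M" for x
  proof -
    have "deriv f x = deriv f (frac x)"
      using minus_of_int[of x "\<lfloor>x\<rfloor>"] by (simp add: frac_def)
    moreover have "frac x \<in> {0..1}"
      using frac_lt_1[of x] by (auto simp: less_imp_le)
    ultimately show ?thesis using M by metis
  qed
  then have M0: "M \<ge> 0" by (meson abs_ge_zero order_trans)
  have Lip: "\<bar>f a - f b\<bar> \<le> M * \<bar>a - b\<bar>" for a b
    using field_differentiable_bound[of UNIV f "deriv f" M a b] D B by auto
  define W where "W = 4 * M + 1"
  have "\<exists>!p. bounce_equations g f (t0, w0) p" if w0: "w0 > W" for t0 w0
  proof -
    define c where "c = 2 / g * w0 + 2 / g * deriv f t0"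
    define q where "q x = (f (t0 + x) - f t0) / x" for x
    have qM: "\<bar>q x\<bar> \<le> M" if "x \<noteq> 0" for x
      using Lip[of "t0 + x" t0] that by (simp add: q_def divide_le_eq)
    have q2: "\<bar>2 / g * q x\<bar> \<le> 2 / g * M" if "x \<noteq> 0" for x
      using qM[OF that] g by (simp add: abs_mult divide_right_mono)
    have c: "c - 2 / g * M > 4 * M / g"
    proof -
      have "w0 + deriv f t0 - M > 2 * M"
        using w0 B[of t0] M0 by (simp add: W_def)
      then have "2 / g * (w0 + deriv f t0 - M) > 2 / g * (2 * M)"
        using g by (intro mult_strict_left_mono) auto
      then show ?thesis by (simp add: c_def algebra_simps add_divide_distrib)
    qed
    have g4: "4 * M / g \<ge> 0" "2 / g * M \<ge> 0" using g M0 by auto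
    have uniq: "x = y"
      if x: "x \<noteq> 0" "x = c - 2 / g * q x" and y: "y \<noteq> 0" "y = c - 2 / g * q y" for x y
    proof (rule ccontr)
      assume ne: "x \<noteq> y"
      have xy: "x > 4 * M / g" "y > 4 * M / g"
        using q2[OF x(1)] q2[OF y(1)] x(2) y(2) c by linarith+
      have pos: "x > 0" "y > 0" using xy g4 by linarith+
      have "q x - q y = (f (t0 + x) - f (t0 + y)) / x + q y * ((y - x) / x)"
        using pos by (simp add: q_def field_simps)
      also have "\<bar>\<dots>\<bar> \<le> M * \<bar>x - y\<bar> / x + M * (\<bar>x - y\<bar> / x)"
      proof (rule order_trans[OF abs_triangle_ineq add_mono])
        show "\<bar>(f (t0 + x) - f (t0 + y)) / x\<bar> \<le> M * \<bar>x - y\<bar> / x"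
          using Lip[of "t0 + x" "t0 + y"] pos by (simp add: divide_right_mono)
        have "\<bar>q y\<bar> * (\<bar>x - y\<bar> / x) \<le> M * (\<bar>x - y\<bar> / x)"
          using qM[of y] pos by (intro mult_right_mono) auto
        then show "\<bar>q y * ((y - x) / x)\<bar> \<le> M * (\<bar>x - y\<bar> / x)"
          using pos by (simp add: abs_mult abs_minus_commute)
      qed
      finally have *: "\<bar>q x - q y\<bar> \<le> 2 * M / x * \<bar>x - y\<bar>" by simp
      have "x - y = - (2 / g * (q x - q y))"
        using x(2) y(2) by (simp add: right_diff_distrib)
      then have "\<bar>x - y\<bar> = 2 / g * \<bar>q x - q y\<bar>"
        using g by (simp only: abs_minus_cancel abs_mult) simp
      also have "\<dots> \<le> 2 / g * (2 * M / x * \<bar>x - y\<bar>)"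
        using * g by (intro mult_left_mono) auto
      also have "\<dots> = (4 * M / g / x) * \<bar>x - y\<bar>" by simp
      also have "\<dots> < 1 * \<bar>x - y\<bar>"
        using xy pos ne divide_less_eq_1_pos[of x "4 * M / g"]
        by (intro mult_strict_right_mono) (simp_all only: zero_less_abs_iff right_minus_eq, simp)
      finally show False by simp
    qed
    obtain x where x: "x \<noteq> 0" "x = c - 2 / g * q x"
    proof -
      let ?a = "c - 2 / g * M" and ?b = "c + 2 / g * M"
      have a: "?a > 0" using c g4 by linarith
      have "continuous_on {?a..?b} (\<lambda>x. x + 2 / g * q x)"
      proof -
        have "continuous_on UNIV f" by (rule differentiable_imp_continuous_on[OF d0])
        then have "continuous_on {?a..?b} (\<lambda>x. f (t0 + x))"
          by (rule continuous_on_compose2) (auto intro!: continuous_intros)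
        then show ?thesis
          unfolding q_def using a by (intro continuous_intros) auto
      qed
      moreover have "?a + 2 / g * q ?a \<le> c" "c \<le> ?b + 2 / g * q ?b"
        using q2[of ?a] q2[of ?b] a g4 by linarith+
      ultimately obtain x where "?a \<le> x" "x + 2 / g * q x = c"
        using IVT'[of "\<lambda>x. x + 2 / g * q x" ?a c ?b] g4 by auto
      then show ?thesis using a that[of x] by linarith
    qed
    have iff: "bounce_equations g f (t0, w0) (t1, w1) \<longleftrightarrow>
        t1 - t0 \<noteq> 0 \<and> t1 - t0 = c - 2 / g * q (t1 - t0) \<and>
        w1 = w0 - 2 * q (t1 - t0) + deriv f t1 + deriv f t0" for t1 w1
      by (auto simp: bounce_equations_def divided_difference_def q_def c_def)
    show ?thesis
    proof (rule ex1I)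
      show "bounce_equations g f (t0, w0)
          (t0 + x, w0 - 2 * q x + deriv f (t0 + x) + deriv f t0)"
        using x unfolding iff by simp
    next
      fix p assume p: "bounce_equations g f (t0, w0) p"
      obtain t1 w1 where pe: "p = (t1, w1)" by (cases p)
      have "t1 - t0 = x"
        using p uniq x unfolding pe iff by blast
      then have "t1 = t0 + x" by simp
      then show "p = (t0 + x, w0 - 2 * q x + deriv f (t0 + x) + deriv f t0)"
        using p unfolding pe iff by simp
    qed
  qed
  then have "admissible_threshold g f W"
    using M0 by (auto simp: admissible_threshold_def W_def)
  then show ?thesis ..
qed

end

(* Impact times of an orbit are the zeros of the defect (takeoff velocity minus landing velocity
   at each impact), which is increasing in the neighbouring impact times once the gaps are large.
   Hence for small \<epsilon> the map x \<mapsto> x + \<epsilon> defect(x) is order preserving and commutes with integer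
   translations, so it preserves the Birkhoff order constraints of a given rotation number.
   For rotation number p/q the periodic Birkhoff sequences form a compact set modulo translation,
   on which an action attains its minimum.  Its partial derivatives are negative multiples of the
   defect, so a minimiser with nonzero defect would be improved by the above map.  Irrational
   rotation numbers follow by compactness. *)

theory Submission
  imports Defs
begin

section \<open>Birkhoff sequences\<close>

text \<open>Every translate \<open>x (n + a) - b\<close> is comparable with \<open>x\<close>, with
  the order prescribed by the sign of \<open>a * \<alpha> - b\<close>. Weak inequalities keep the
  condition closed under pointwise limits. The case \<open>a * \<alpha> = b\<close> is left free;
  periodicity is imposed separately for rational \<alpha>.\<close>

definition birkhoff :: "real \<Rightarrow> (int \<Rightarrow> real) \<Rightarrow> bool" where
  "birkhoff \<alpha> x \<longleftrightarrow>
     (\<forall>n a b. (of_int a * \<alpha> < of_int b \<longrightarrow> x (n + a) \<le> x n + of_int b) \<and>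
              (of_int b < of_int a * \<alpha> \<longrightarrow> x n + of_int b \<le> x (n + a)))"

text \<open>The least integer strictly above \<open>a * \<alpha>\<close> exceeds it by at most 1.
  With the matching lower bound, the sequence stays within 1 of a line of slope \<alpha>, so
  \<alpha> is its mean gap.\<close>

lemma birkhoff_upper:
  assumes x: "birkhoff \<alpha> x"
  shows "x (n + a) \<le> x n + of_int a * \<alpha> + 1"
proof -
  have "of_int a * \<alpha> < of_int (\<lfloor>of_int a * \<alpha>\<rfloor> + 1)" by linarith
  then have "x (n + a) \<le> x n + of_int (\<lfloor>of_int a * \<alpha>\<rfloor> + 1)"
    using x unfolding birkhoff_def by blast
  then show ?thesis by linarith
qed

lemma birkhoff_lower:
  assumes x: "birkhoff \<alpha> x"
  shows "x n + of_int a * \<alpha> - 1 \<le> x (n + a)"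
proof -
  have "of_int (\<lceil>of_int a * \<alpha>\<rceil> - 1) < of_int a * \<alpha>" by linarith
  then have "x n + of_int (\<lceil>of_int a * \<alpha>\<rceil> - 1) \<le> x (n + a)"
    using x unfolding birkhoff_def by blast
  then show ?thesis by linarith
qed

lemma birkhoff_gap: "birkhoff \<alpha> x \<Longrightarrow> \<alpha> - 1 \<le> x (n + 1) - x n"
  using birkhoff_lower[of \<alpha> x n 1] by simp

lemma birkhoff_linear: "birkhoff \<alpha> (\<lambda>n. of_int n * \<alpha>)"
  by (simp add: birkhoff_def algebra_simps)

lemma birkhoff_translate: "birkhoff \<alpha> x \<Longrightarrow> birkhoff \<alpha> (\<lambda>n. x n + c)"
  by (auto simp: birkhoff_def algebra_simps)

section \<open>Closed and compact sets of sequences in the product topology\<close>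

lemma continuous_on_coordinate:
  "continuous_on S (\<lambda>x :: 'a \<Rightarrow> 'b::topological_space. x i)"
  by (rule continuous_on_subset[OF continuous_on_product_coordinates]) simp

lemma compact_Collect_between:
  fixes l u :: "'a \<Rightarrow> real"
  shows "compact {x. \<forall>i. l i \<le> x i \<and> x i \<le> u i}"
proof -
  have "{x. \<forall>i. l i \<le> x i \<and> x i \<le> u i} = PiE UNIV (\<lambda>i. {l i..u i})"
    by (auto simp: PiE_def Pi_def)
  moreover have "compactin (product_topology (\<lambda>i. euclidean) UNIV) (PiE UNIV (\<lambda>i. {l i..u i}))"
    by (simp add: compactin_PiE)
  ultimately show ?thesis
    by (simp add: euclidean_product_topology)
qed

lemma closed_birkhoff: "closed {x. birkhoff \<alpha> x}"
  unfolding birkhoff_def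
  by (intro closed_Collect_all closed_Collect_conj closed_Collect_imp open_Collect_const
      closed_Collect_le continuous_intros continuous_on_coordinate)

text \<open>The difference of the two sums telescopes to \<open>G q - G 0\<close>. It serves to
  collect, at each impact, the contributions of both adjacent flights.\<close>

lemma sum_int_shift_periodic:
  fixes G :: "int \<Rightarrow> real"
  assumes "\<And>i. G (i + int q) = G i"
  shows "(\<Sum>i<q. G (int i + 1)) = (\<Sum>i<q. G (int i))"
proof -
  have "(\<Sum>i<q. G (int i + 1) - G (int i)) = G (int q) - G 0"
    using sum_lessThan_telescope[of "\<lambda>i. G (int i)" q] by (simp add: add.commute)
  then show ?thesis using assms[of 0] by (simp add: sum_subtractf)
qed

section \<open>The bounce recurrence\<close>

lemma deriv_periodic:
  fixes h :: "real \<Rightarrow> real"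
  assumes D: "\<And>x. (h has_real_derivative deriv h x) (at x)" and per: "\<And>x. h (x + 1) = h x"
  shows "deriv h (x + 1) = deriv h x"
proof -
  have "((\<lambda>x. h (x + 1)) has_real_derivative deriv h (x + 1)) (at x)"
    using D[of "x + 1"] by (simp add: DERIV_shift)
  then show ?thesis
    using D[of x] per DERIV_unique by simp blast
qed

lemma continuous_periodic_bounded:
  fixes h :: "real \<Rightarrow> real"
  assumes cont: "continuous_on UNIV h" and per: "\<And>x. h (x + 1) = h x"
  obtains B where "\<And>x. \<bar>h x\<bar> \<le> B"
proof -
  interpret periodic_fun_simple' h by unfold_locales (rule per)
  have "compact (h ` {0..1})"
    using cont by (intro compact_continuous_image) (auto intro: continuous_on_subset)
  then obtain B where B: "\<And>x. x \<in> {0..1} \<Longrightarrow> \<bar>h x\<bar> \<le> B"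
    using bounded_iff[of "h ` {0..1}"] compact_imp_bounded by force
  have "\<bar>h x\<bar> \<le> B" for x
    using B[of "frac x"] minus_of_int[of x "\<lfloor>x\<rfloor>"] frac_lt_1[of x]
    by (simp add: frac_def less_imp_le)
  then show ?thesis by (rule that)
qed

text \<open>\<open>M\<close> bounds the speed of the racket and \<open>K\<close> is a Lipschitz
  constant of its velocity; all later thresholds are expressed through \<open>g\<close>,
  \<open>M\<close> and \<open>K\<close>.\<close>

locale racket =
  fixes g :: real and f :: "real \<Rightarrow> real" and M K :: real
  assumes g_pos: "g > 0"
    and f_deriv: "\<And>x. (f has_real_derivative deriv f x) (at x)"
    and per: "\<And>x. f (x + 1) = f x"
    and deriv_bound: "\<And>x. \<bar>deriv f x\<bar> \<le> M"
    and deriv_lipschitz: "\<And>x y. \<bar>deriv f x - deriv f y\<bar> \<le> K * \<bar>x - y\<bar>"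
begin

lemma f_lipschitz: "\<bar>f a - f b\<bar> \<le> M * \<bar>a - b\<bar>"
  using field_differentiable_bound[of UNIV f "deriv f" M a b] f_deriv deriv_bound by auto

lemma f_cont: "continuous_on S f"
  using f_deriv by (meson DERIV_atLeastAtMost_imp_continuous_on DERIV_isCont
      continuous_at_imp_continuous_on)

lemma deriv_cont: "continuous_on S (deriv f)"
proof (rule continuous_on_subset[of UNIV])
  have "K-lipschitz_on UNIV (deriv f)"
    using deriv_lipschitz[of 0 1] deriv_lipschitz
    by (auto intro!: lipschitz_onI simp: dist_real_def)
  then show "continuous_on UNIV (deriv f)" by (rule lipschitz_on_continuous_on)
qed simp

lemma M_nonneg: "M \<ge> 0"
  using deriv_bound[of 0] by linarith

lemma K_nonneg: "K \<ge> 0"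
  using deriv_lipschitz[of 0 1] by auto

sublocale f: periodic_fun_simple' f
  by unfold_locales (rule per)

sublocale df: periodic_fun_simple' "deriv f"
  by unfold_locales (rule deriv_periodic[OF f_deriv per])

abbreviation slope :: "real \<Rightarrow> real \<Rightarrow> real" where
  "slope a b \<equiv> divided_difference f b a"

lemma slope_sym: "slope a b = slope b a"
  unfolding divided_difference_def by (metis minus_diff_eq minus_divide_divide)

lemma slope_bound: "\<bar>slope a b\<bar> \<le> M"
  using f_lipschitz[of b a] M_nonneg
  by (cases "a = b") (simp_all add: divided_difference_def divide_le_eq)

text \<open>The difference can be written with denominator \<open>b - a\<close> alone, the other
  quotient being bounded by \<open>M\<close>. Hence only one of the two gaps must be at least
  \<open>L\<close>.\<close>

lemma slope_lipschitz:
  assumes "L > 0" "\<bar>b - a\<bar> \<ge> L" "c \<noteq> a"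
  shows "\<bar>slope a b - slope a c\<bar> \<le> 2 * M / L * \<bar>b - c\<bar>"
proof -
  have ba: "b - a \<noteq> 0" "c - a \<noteq> 0" using assms by auto
  have "slope a b - slope a c = (f b - f c) / (b - a) + slope a c * (c - b) / (b - a)"
    using ba by (simp add: divided_difference_def divide_simps) (simp add: algebra_simps)
  also have "\<dots> = ((f b - f c) + slope a c * (c - b)) / (b - a)"
    by (simp add: add_divide_distrib)
  also have "\<bar>\<dots>\<bar> \<le> (2 * M * \<bar>b - c\<bar>) / L"
    unfolding abs_divide
  proof (rule frac_le)
    have "\<bar>slope a c * (c - b)\<bar> \<le> M * \<bar>b - c\<bar>"
      by (simp add: abs_mult abs_minus_commute mult_right_mono slope_bound)
    then show "\<bar>f b - f c + slope a c * (c - b)\<bar> \<le> 2 * M * \<bar>b - c\<bar>"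
      using f_lipschitz[of b c] by linarith
  qed (use assms M_nonneg in auto)
  finally show ?thesis by simp
qed

text \<open>The first bounce equation solved for \<open>w0\<close>: the velocity relative to the
  racket with which the ball must leave at \<open>a\<close> to hit at \<open>b\<close>.\<close>

definition takeoff :: "real \<Rightarrow> real \<Rightarrow> real" where
  "takeoff a b = g / 2 * (b - a) + slope a b - deriv f a"

text \<open>The value of \<open>w1\<close> after inserting \<open>takeoff a b\<close> for
  \<open>w0\<close>: the relative velocity just after the elastic impact at
  \<open>b\<close>.\<close>

definition landing :: "real \<Rightarrow> real \<Rightarrow> real" where
  "landing a b = g / 2 * (b - a) - slope a b + deriv f b"

definition defect :: "(int \<Rightarrow> real) \<Rightarrow> int \<Rightarrow> real" where
  "defect x n = takeoff (x n) (x (n + 1)) - landing (x (n - 1)) (x n)"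

lemma takeoff_lower: "takeoff a b \<ge> g / 2 * (b - a) - 2 * M"
  using slope_bound[of b a] deriv_bound[of a] by (simp add: takeoff_def)

lemma landing_lower: "landing a b \<ge> g / 2 * (b - a) - 2 * M"
  using slope_bound[of b a] deriv_bound[of b] by (simp add: landing_def)

lemma takeoff_translate: "takeoff (a + of_int k) (b + of_int k) = takeoff a b"
  by (simp add: takeoff_def divided_difference_def f.plus_of_int df.plus_of_int)

lemma landing_translate: "landing (a + of_int k) (b + of_int k) = landing a b"
  by (simp add: landing_def divided_difference_def f.plus_of_int df.plus_of_int)

lemma defect_translate:
  "defect (\<lambda>n. x (n + a) + of_int b) n = defect x (n + a)"
  unfolding defect_def takeoff_translate landing_translate by (simp add: algebra_simps)

text \<open>Shifting the index by \<open>a\<close> and raising the values by \<open>p\<close> give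
  the same sequence, and the defect is equivariant under both.\<close>

lemma defect_periodic:
  assumes "\<And>i. x (i + a) = x i + of_int p"
  shows "defect x (n + a) = defect x n"
  using defect_translate[of x a 0 n] defect_translate[of x 0 p n] by (simp add: assms)

lemma bounce_equations_takeoff:
  assumes "a \<noteq> b"
  shows "bounce_equations g f (a, takeoff a b) (b, landing a b)"
  using assms g_pos
  by (simp add: bounce_equations_def takeoff_def landing_def divide_simps)
     (simp add: algebra_simps)

text \<open>Gaps of at least \<open>L\<close> keep every takeoff velocity above \<open>wbar\<close>,
  where the bounce equations have a unique solution; zero defect makes consecutive solutions fit
  together.\<close>

lemma orbit_of_defect_zero:
  assumes adm: "admissible_threshold g f wbar"
    and gap: "\<And>n. L \<le> x (n + 1) - x n" and L: "L > 0" "g / 2 * L - 2 * M > wbar"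
    and zero: "\<And>n. defect x n = 0"
  shows "bouncing_ball_orbit g f wbar x (\<lambda>n. takeoff (x n) (x (n + 1)))"
  unfolding bouncing_ball_orbit_def
proof (intro allI conjI)
  fix n
  have "g / 2 * L \<le> g / 2 * (x (n + 1) - x n)"
    using gap g_pos by (intro mult_left_mono) auto
  then show big: "takeoff (x n) (x (n + 1)) > wbar"
    using takeoff_lower[of "x (n + 1)" "x n"] L by linarith
  have "x n \<noteq> x (n + 1)" using gap[of n] L by auto
  then have eq: "bounce_equations g f (x n, takeoff (x n) (x (n + 1)))
      (x (n + 1), landing (x n) (x (n + 1)))"
    by (rule bounce_equations_takeoff)
  have "landing (x n) (x (n + 1)) = takeoff (x (n + 1)) (x (n + 1 + 1))"
    using zero[of "n + 1"] by (simp add: defect_def)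
  moreover have "bouncing_ball_map g f (x n, takeoff (x n) (x (n + 1))) =
      (x (n + 1), landing (x n) (x (n + 1)))"
    unfolding bouncing_ball_map_def
    using adm big eq unfolding admissible_threshold_def by (metis the1_equality)
  ultimately show "bouncing_ball_map g f (x n, takeoff (x n) (x (n + 1))) =
      (x (n + 1), takeoff (x (n + 1)) (x (n + 1 + 1)))" by simp
qed

section \<open>The monotone relaxation step\<close>

text \<open>One explicit step of the flow \<open>x' = defect x\<close>, which is also a direction of
  descent for the action when the gaps are large.\<close>

definition relax :: "real \<Rightarrow> (int \<Rightarrow> real) \<Rightarrow> int \<Rightarrow> real" where
  "relax \<epsilon> x n = x n + \<epsilon> * defect x n"

text \<open>The linear part contributes \<open>- g / 2\<close> times each neighbouring difference.
  For \<open>L\<close> at least \<open>4 * M / g\<close> the divided differences contribute at most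
  \<open>g / 2\<close> times it, so only the term at \<open>n\<close> itself survives.\<close>

lemma defect_mono:
  assumes L: "L > 0" "4 * M / g \<le> L"
    and x: "\<And>n. L \<le> x (n + 1) - x n" and y: "\<And>n. L \<le> y (n + 1) - y n"
    and le: "\<And>n. x n \<le> y n"
  shows "defect x n - defect y n \<le> 2 * (g + K) * (y n - x n)"
proof -
  define d where "d k = y k - x k" for k
  have d0: "d k \<ge> 0" for k using le by (simp add: d_def)
  have step: "\<bar>slope (x k) (x (k + 1)) - slope (y k) (y (k + 1))\<bar>
      \<le> g / 2 * (d (k + 1) + d k)" for k
  proof -
    have c: "2 * M / L \<le> g / 2"
      using L g_pos by (simp add: field_simps)
    \<comment> \<open>The endpoints are moved from \<open>x\<close> to \<open>y\<close> one at a
      time, the right one first.\<close>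
    have "\<bar>slope (x k) (x (k + 1)) - slope (x k) (y (k + 1))\<bar>
        \<le> 2 * M / L * \<bar>x (k + 1) - y (k + 1)\<bar>"
      using L x[of k] le[of "k + 1"] by (intro slope_lipschitz) auto
    also have "\<dots> \<le> g / 2 * \<bar>x (k + 1) - y (k + 1)\<bar>"
      by (rule mult_right_mono[OF c]) simp
    also have "\<bar>x (k + 1) - y (k + 1)\<bar> = d (k + 1)"
      using le[of "k + 1"] by (simp add: d_def)
    finally have 1: "\<bar>slope (x k) (x (k + 1)) - slope (x k) (y (k + 1))\<bar> \<le> g / 2 * d (k + 1)" .
    \<comment> \<open>The mixed gap \<open>y (k + 1) - x k\<close> is at least
      \<open>x (k + 1) - x k\<close>, hence at least \<open>L\<close>.\<close>
    have "\<bar>slope (y (k + 1)) (x k) - slope (y (k + 1)) (y k)\<bar>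
        \<le> 2 * M / L * \<bar>x k - y k\<bar>"
      using L x[of k] y[of k] le[of "k + 1"] by (intro slope_lipschitz) auto
    also have "\<dots> \<le> g / 2 * \<bar>x k - y k\<bar>"
      by (rule mult_right_mono[OF c]) simp
    also have "\<bar>x k - y k\<bar> = d k"
      using le[of k] by (simp add: d_def)
    finally have 2: "\<bar>slope (x k) (y (k + 1)) - slope (y k) (y (k + 1))\<bar> \<le> g / 2 * d k"
      by (metis slope_sym)
    show ?thesis
      using 1 2 unfolding distrib_left by linarith
  qed
  have "K * \<bar>x n - y n\<bar> = K * d n"
    using le[of n] by (simp add: d_def)
  then have df: "\<bar>deriv f (x n) - deriv f (y n)\<bar> \<le> K * d n"
    using deriv_lipschitz[of "x n" "y n"] by linarith
  have "defect x n - defect y n =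
      - (g / 2 * (d (n + 1) + d (n - 1))) + g * d n
      + (slope (x n) (x (n + 1)) - slope (y n) (y (n + 1)))
      + (slope (x (n - 1)) (x n) - slope (y (n - 1)) (y n))
      + 2 * (deriv f (y n) - deriv f (x n))"
    by (simp add: defect_def takeoff_def landing_def d_def field_simps)
  also have "\<dots> \<le> - (g / 2 * (d (n + 1) + d (n - 1))) + g * d n
      + g / 2 * (d (n + 1) + d n) + g / 2 * (d n + d (n - 1)) + 2 * (K * d n)"
    using abs_le_D1[OF step[of n]] abs_le_D1[OF step[of "n - 1"]] abs_le_D2[OF df]
    by (intro add_mono mult_left_mono order_refl) simp_all
  also have "\<dots> = 2 * (g + K) * d n"
    by (simp add: field_simps)
  finally show ?thesis by (simp add: d_def)
qed

text \<open>The defect can fall by at most \<open>2 * (g + K)\<close> times the distance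
  \<open>y n - x n\<close>; a step with \<epsilon> times this constant at most 1 cannot overshoot
  that distance.\<close>

lemma relax_mono:
  assumes L: "L > 0" "4 * M / g \<le> L" and \<epsilon>: "0 \<le> \<epsilon>" "\<epsilon> * (2 * (g + K)) \<le> 1"
    and "\<And>n. L \<le> x (n + 1) - x n" "\<And>n. L \<le> y (n + 1) - y n" "\<And>n. x n \<le> y n"
  shows "relax \<epsilon> x n \<le> relax \<epsilon> y n"
proof -
  have "\<epsilon> * (defect x n - defect y n) \<le> \<epsilon> * (2 * (g + K) * (y n - x n))"
    by (intro mult_left_mono defect_mono[OF L] assms)
  also have "\<dots> = \<epsilon> * (2 * (g + K)) * (y n - x n)" by simp
  also have "\<dots> \<le> 1 * (y n - x n)"
    using \<epsilon> assms(7) by (intro mult_right_mono) auto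
  finally show ?thesis by (simp add: relax_def algebra_simps)
qed

lemma relax_translate:
  "relax \<epsilon> (\<lambda>n. x (n + a) + of_int b) n = relax \<epsilon> x (n + a) + of_int b"
  unfolding relax_def defect_translate by simp

lemma relax_birkhoff:
  assumes \<alpha>: "1 < \<alpha>" "4 * M / g \<le> \<alpha> - 1" and \<epsilon>: "0 \<le> \<epsilon>" "\<epsilon> * (2 * (g + K)) \<le> 1"
    and x: "birkhoff \<alpha> x"
  shows "birkhoff \<alpha> (relax \<epsilon> x)"
  unfolding birkhoff_def
proof (intro allI conjI impI)
  fix n a b :: int
  \<comment> \<open>Both Birkhoff inequalities compare \<open>x\<close> with this translate, and
    relaxation preserves the order and commutes with the translation.\<close>
  define y where "y = (\<lambda>n. x (n + a) + of_int (- b))"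
  have gy: "\<alpha> - 1 \<le> y (k + 1) - y k" for k
    using birkhoff_gap[OF x, of "k + a"] by (simp add: y_def add_ac)
  have ry: "relax \<epsilon> y n = relax \<epsilon> x (n + a) + of_int (- b)"
    unfolding y_def by (rule relax_translate)
  note mono = relax_mono[OF _ \<alpha>(2) \<epsilon>]
  show "relax \<epsilon> x (n + a) \<le> relax \<epsilon> x n + of_int b" if "of_int a * \<alpha> < of_int b"
  proof -
    have "y k \<le> x k" for k
    proof -
      have "x (k + a) \<le> x k + of_int b" using x that unfolding birkhoff_def by blast
      then show ?thesis by (simp add: y_def)
    qed
    then have "relax \<epsilon> y n \<le> relax \<epsilon> x n"
      using \<alpha> gy birkhoff_gap[OF x] by (intro mono) auto
    then show ?thesis using ry by simp
  qed
  show "relax \<epsilon> x n + of_int b \<le> relax \<epsilon> x (n + a)" if "of_int b < of_int a * \<alpha>"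
  proof -
    have "x k \<le> y k" for k
    proof -
      have "x k + of_int b \<le> x (k + a)" using x that unfolding birkhoff_def by blast
      then show ?thesis by (simp add: y_def)
    qed
    then have "relax \<epsilon> x n \<le> relax \<epsilon> y n"
      using \<alpha> gy birkhoff_gap[OF x] by (intro mono) auto
    then show ?thesis using ry by simp
  qed
qed

section \<open>The action\<close>

text \<open>
  The generating function with momentum \<open>(w\<^sup>2 - (deriv f t)\<^sup>2) / 2\<close> at impact time \<open>t\<close> has the further
  term \<open>- g * integral {a..b} f\<close>. Its sum over a period is constant on periodic sequences, so it is
  omitted.
\<close>

definition gen :: "real \<Rightarrow> real \<Rightarrow> real" where
  "gen a b = g\<^sup>2 / 24 * (b - a) ^ 3 + g / 2 * (f a + f b) * (b - a)
     - (f b - f a)\<^sup>2 / (2 * (b - a))"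

lemma gen_translate: "gen (a + of_int k) (b + of_int k) = gen a b"
  by (simp add: gen_def f.plus_of_int)

text \<open>Both partial derivatives at once, along the direction \<open>(u, v)\<close>. The terms
  with \<open>(deriv f)\<^sup>2\<close> and \<open>g * f\<close> have opposite signs at the two
  endpoints, so they cancel at each impact once two adjacent flights are added.\<close>

lemma gen_deriv:
  assumes "a \<noteq> b"
  shows "((\<lambda>s. gen (a + s * u) (b + s * v)) has_real_derivative
      (- (takeoff a b)\<^sup>2 / 2 + (deriv f a)\<^sup>2 / 2 - g * f a) * u
    + ((landing a b)\<^sup>2 / 2 - (deriv f b)\<^sup>2 / 2 + g * f b) * v) (at 0)"
proof -
  have fa: "((\<lambda>s. f (a + s * u)) has_real_derivative deriv f a * u) (at 0)"
    by (rule DERIV_chain'[where f = "\<lambda>s. a + s * u"]) (auto intro!: derivative_eq_intros simp: f_deriv)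
  have fb: "((\<lambda>s. f (b + s * v)) has_real_derivative deriv f b * v) (at 0)"
    by (rule DERIV_chain'[where f = "\<lambda>s. b + s * v"]) (auto intro!: derivative_eq_intros simp: f_deriv)
  have ba: "b - a \<noteq> 0" using assms by simp
  define d where "d = b - a"
  define D where "D = slope a b"
  have d: "d \<noteq> 0" using ba by (simp add: d_def)
  have D: "f b - f a = D * d"
    using ba by (simp add: D_def divided_difference_def d_def)
  have gap: "((\<lambda>s. (b + s * v) - (a + s * u)) has_real_derivative v - u) (at 0)"
    by (auto intro!: derivative_eq_intros)
  have quot: "((\<lambda>s. (f (b + s * v) - f (a + s * u))\<^sup>2 / (2 * ((b + s * v) - (a + s * u))))
      has_real_derivative D * (deriv f b * v - deriv f a * u) - D\<^sup>2 * (v - u) / 2) (at 0)"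
  \<comment> \<open>The quotient rule gives the raw derivative; substituting \<open>D * d\<close>
    for \<open>f b - f a\<close> then cancels the powers of \<open>d\<close>.\<close>
  proof (rule DERIV_cong)
    show "((\<lambda>s. (f (b + s * v) - f (a + s * u))\<^sup>2 / (2 * ((b + s * v) - (a + s * u))))
      has_real_derivative
        (of_nat 2 * ((deriv f b * v - deriv f a * u) * (f (b + 0 * v) - f (a + 0 * u)) ^ (2 - Suc 0))
           * (2 * ((b + 0 * v) - (a + 0 * u)))
         - (f (b + 0 * v) - f (a + 0 * u))\<^sup>2 * (2 * (v - u)))
          / ((2 * ((b + 0 * v) - (a + 0 * u))) * (2 * ((b + 0 * v) - (a + 0 * u))))) (at 0)"
      using ba by (intro DERIV_divide DERIV_power DERIV_diff DERIV_cmult fa fb gap) simp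
    have "(2 * ((deriv f b * v - deriv f a * u) * (D * d)) * (2 * d)
        - (D * d)\<^sup>2 * (2 * (v - u))) / ((2 * d) * (2 * d))
      = D * (deriv f b * v - deriv f a * u) - D\<^sup>2 * (v - u) / 2"
      using d by (simp add: field_simps power2_eq_square)
    then show "(of_nat 2 * ((deriv f b * v - deriv f a * u) * (f (b + 0 * v) - f (a + 0 * u)) ^ (2 - Suc 0))
           * (2 * ((b + 0 * v) - (a + 0 * u)))
         - (f (b + 0 * v) - f (a + 0 * u))\<^sup>2 * (2 * (v - u)))
          / ((2 * ((b + 0 * v) - (a + 0 * u))) * (2 * ((b + 0 * v) - (a + 0 * u))))
      = D * (deriv f b * v - deriv f a * u) - D\<^sup>2 * (v - u) / 2"
      by (simp only: mult_zero_left add_0_right D d_def[symmetric]) simp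
  qed
  have fb_eq: "f b = f a + D * d" using D by simp
  have "((\<lambda>s. gen (a + s * u) (b + s * v)) has_real_derivative
      g\<^sup>2 / 24 * (3 * d\<^sup>2 * (v - u))
      + (g / 2 * (deriv f a * u + deriv f b * v) * d + g / 2 * (f a + f b) * (v - u))
      - (D * (deriv f b * v - deriv f a * u) - D\<^sup>2 * (v - u) / 2)) (at 0)"
    unfolding gen_def
  proof (intro DERIV_diff DERIV_add quot)
    have "((\<lambda>s. g\<^sup>2 / 24 * ((b + s * v) - (a + s * u)) ^ 3) has_real_derivative
      g\<^sup>2 / 24 * (of_nat 3 * ((v - u) * ((b + 0 * v) - (a + 0 * u)) ^ (3 - Suc 0)))) (at 0)"
      by (intro DERIV_cmult DERIV_power gap)
    then show "((\<lambda>s. g\<^sup>2 / 24 * (b + s * v - (a + s * u)) ^ 3) has_real_derivative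
      g\<^sup>2 / 24 * (3 * d\<^sup>2 * (v - u))) (at 0)"
      by (simp add: d_def mult_ac)
    have "((\<lambda>s. g / 2 * (f (a + s * u) + f (b + s * v)) * (b + s * v - (a + s * u)))
      has_real_derivative
        g / 2 * (deriv f a * u + deriv f b * v) * (b + 0 * v - (a + 0 * u))
        + (v - u) * (g / 2 * (f (a + 0 * u) + f (b + 0 * v)))) (at 0)"
      by (intro DERIV_mult DERIV_cmult DERIV_add fa fb gap)
    then show "((\<lambda>s. g / 2 * (f (a + s * u) + f (b + s * v)) * (b + s * v - (a + s * u)))
      has_real_derivative
        g / 2 * (deriv f a * u + deriv f b * v) * d + g / 2 * (f a + f b) * (v - u)) (at 0)"
      by (simp add: d_def mult_ac)
  qed
  \<comment> \<open>After replacing \<open>f b\<close> by \<open>f a + D * d\<close> this is a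
    polynomial identity that completes the squares of takeoff and landing velocity.\<close>
  also have "g\<^sup>2 / 24 * (3 * d\<^sup>2 * (v - u))
      + (g / 2 * (deriv f a * u + deriv f b * v) * d + g / 2 * (f a + f b) * (v - u))
      - (D * (deriv f b * v - deriv f a * u) - D\<^sup>2 * (v - u) / 2)
    = (- (takeoff a b)\<^sup>2 / 2 + (deriv f a)\<^sup>2 / 2 - g * f a) * u
    + ((landing a b)\<^sup>2 / 2 - (deriv f b)\<^sup>2 / 2 + g * f b) * v"
    unfolding takeoff_def landing_def d_def[symmetric] D_def[symmetric] fb_eq
    by (simp add: field_simps power2_eq_square)
  finally show ?thesis .
qed

text \<open>At impact \<open>i\<close> the two adjacent flights leave half of landing squared minus
  takeoff squared. This factors as minus the mean velocity times the defect; the direction supplies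
  the second factor \<open>defect\<close>.\<close>

lemma action_deriv:
  assumes x: "\<And>i. x (i + 1) \<noteq> x i" and p: "\<And>i. x (i + int q) = x i + of_int p"
  shows "((\<lambda>s. \<Sum>i<q. gen (relax s x (int i)) (relax s x (int i + 1))) has_real_derivative
    (- (\<Sum>i<q. (takeoff (x (int i)) (x (int i + 1)) + landing (x (int i - 1)) (x (int i))) / 2
        * (defect x (int i))\<^sup>2))) (at 0)"
proof -
  define P where "P i = - (takeoff (x i) (x (i + 1)))\<^sup>2 / 2 + (deriv f (x i))\<^sup>2 / 2 - g * f (x i)" for i
  define Q where "Q i = (landing (x (i - 1)) (x i))\<^sup>2 / 2 - (deriv f (x i))\<^sup>2 / 2 + g * f (x i)" for i
  have p1: "x (int q + i) = x i + of_int p" for i using p[of i] by (simp add: add.commute)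
  note per_defect = defect_periodic[of x, OF p]
  have per_Q: "Q (i + int q) = Q i" for i
  proof -
    have "x (i + int q - 1) = x (i - 1) + of_int p"
      using p[of "i - 1"] by (simp add: algebra_simps)
    then show ?thesis
      using p[of i] by (simp add: Q_def landing_translate f.plus_of_int df.plus_of_int)
  qed
  have "((\<lambda>s. \<Sum>i<q. gen (relax s x (int i)) (relax s x (int i + 1))) has_real_derivative
      (\<Sum>i<q. P (int i) * defect x (int i) + Q (int i + 1) * defect x (int i + 1))) (at 0)"
    unfolding relax_def
  proof (rule DERIV_sum)
    fix i
    show "((\<lambda>s. gen (x (int i) + s * defect x (int i)) (x (int i + 1) + s * defect x (int i + 1)))
      has_real_derivative P (int i) * defect x (int i) + Q (int i + 1) * defect x (int i + 1)) (at 0)"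
      using gen_deriv[OF x[of "int i", symmetric], of "defect x (int i)" "defect x (int i + 1)"]
      by (simp add: P_def Q_def)
  qed
  \<comment> \<open>Periodicity allows the \<open>Q\<close> terms to be reindexed, so that both
    terms of an impact meet.\<close>
  also have "(\<Sum>i<q. P (int i) * defect x (int i) + Q (int i + 1) * defect x (int i + 1))
    = (\<Sum>i<q. P (int i) * defect x (int i) + Q (int i) * defect x (int i))"
    using sum_int_shift_periodic[of "\<lambda>i. Q i * defect x i" q]
    by (simp add: sum.distrib per_Q per_defect)
  also have "\<dots> = (\<Sum>i<q. - ((takeoff (x (int i)) (x (int i + 1))
      + landing (x (int i - 1)) (x (int i))) / 2 * (defect x (int i))\<^sup>2))"
    by (intro sum.cong refl)
       (simp add: P_def Q_def defect_def field_simps power2_eq_square)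
  finally show ?thesis by (simp only: sum_negf)
qed

section \<open>Periodic minimisers for rational mean gap\<close>

lemma periodic_defect_zero:
  assumes q: "q > 0" and \<alpha>: "\<alpha> = of_int p / of_nat q" "1 < \<alpha>" "4 * M / g \<le> \<alpha> - 1"
    "2 * M < g / 2 * (\<alpha> - 1)"
  obtains x where "birkhoff \<alpha> x" "\<And>n. defect x n = 0" "0 \<le> x 0" "x 0 \<le> 1"
proof -
  define act where "act x = (\<Sum>i<q. gen (x (int i)) (x (int i + 1)))" for x
  define X where "X = {x. birkhoff \<alpha> x \<and> (\<forall>i. x (i + int q) = x i + of_int p)}"
  \<comment> \<open>The bounds on all coordinates follow from \<open>0 \<le> x 0 \<le> 1\<close> for
    Birkhoff sequences; stating them places the set inside a compact box.\<close>
  define X0 where "X0 = X \<inter> {x. \<forall>i. of_int i * \<alpha> - 1 \<le> x i \<and> x i \<le> of_int i * \<alpha> + 2}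
      \<inter> {x. 0 \<le> x 0 \<and> x 0 \<le> 1}"
  have gap: "0 < x (i + 1) - x i" if "x \<in> X" for x i
    using birkhoff_gap[of \<alpha> x i] that \<alpha> by (simp add: X_def)
  have X_translate: "(\<lambda>i. x i + of_int k) \<in> X" if "x \<in> X" for x k
    using that by (auto simp: X_def intro: birkhoff_translate)
  have X0I: "x \<in> X0" if x: "x \<in> X" "0 \<le> x 0" "x 0 \<le> 1" for x
  proof -
    have "of_int i * \<alpha> - 1 \<le> x i \<and> x i \<le> of_int i * \<alpha> + 2" for i
      using birkhoff_lower[of \<alpha> x 0 i] birkhoff_upper[of \<alpha> x 0 i] x by (auto simp: X_def)
    then show ?thesis using x by (simp add: X0_def)
  qed
  have "closed (X \<inter> {x. 0 \<le> x 0 \<and> x 0 \<le> 1})"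
    unfolding X_def Collect_conj_eq
    by (intro closed_Int closed_birkhoff closed_Collect_all closed_Collect_eq
      closed_Collect_le continuous_intros continuous_on_coordinate)
  then have "compact X0"
    using closed_Int_compact[OF _ compact_Collect_between[of "\<lambda>i. of_int i * \<alpha> - 1" "\<lambda>i. of_int i * \<alpha> + 2"]]
    by (metis (no_types, lifting) X0_def inf_assoc inf_commute)
  moreover have "(\<lambda>i. of_int i * \<alpha>) \<in> X"
    using q \<alpha>(1) birkhoff_linear[of \<alpha>] unfolding X_def by (simp add: distrib_right add_divide_distrib)
  then have "X0 \<noteq> {}" using X0I by fastforce
  moreover have "continuous_on X0 act"
  proof -
    have cf: "continuous_on X0 (\<lambda>x. f (x i))" for i :: int
      by (rule continuous_on_compose2[OF f_cont[of UNIV] continuous_on_coordinate]) simp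
    have "x (i + 1) - x i \<noteq> 0" if "x \<in> X0" for x i
      using gap[of x i] that by (auto simp: X0_def)
    then show ?thesis
      unfolding act_def gen_def
      by (intro continuous_intros cf continuous_on_coordinate) auto
  qed
  ultimately obtain x where x: "x \<in> X0" and min0: "\<And>y. y \<in> X0 \<Longrightarrow> act x \<le> act y"
    using continuous_attains_inf[of X0 act] by blast
  \<comment> \<open>Integer translations leave the action unchanged and bring \<open>y 0\<close>
    into the unit interval, so the minimum over \<open>X0\<close> is one over
    \<open>X\<close>.\<close>
  have min: "act x \<le> act y" if "y \<in> X" for y
  proof -
    define z where "z = (\<lambda>i. y i + of_int (- \<lfloor>y 0\<rfloor>))"
    have "z \<in> X" unfolding z_def by (rule X_translate[OF that])
    moreover have "0 \<le> z 0" "z 0 \<le> 1" unfolding z_def by (simp_all, linarith)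
    ultimately have "act x \<le> act z" by (intro min0 X0I)
    also have "act z = act y" unfolding act_def z_def gen_translate ..
    finally show ?thesis .
  qed
  have xX: "x \<in> X" and xB: "birkhoff \<alpha> x" and xp: "\<And>i. x (i + int q) = x i + of_int p"
    using x by (auto simp: X0_def X_def)
  define c where "c i = (takeoff (x i) (x (i + 1)) + landing (x (i - 1)) (x i)) / 2" for i
  have c: "c i > 0" for i
  proof -
    have "2 * M < g / 2 * (x (j + 1) - x j)" for j
      using mult_left_mono[OF birkhoff_gap[OF xB, of j], of "g / 2"] \<alpha> g_pos by linarith
    from this[of i] this[of "i - 1"] show ?thesis
      using takeoff_lower[of "x (i + 1)" "x i"] landing_lower[of "x i" "x (i - 1)"]
      by (simp add: c_def)
  qed
  note per_defect = defect_periodic[of x, OF xp]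
  have der: "((\<lambda>s. act (relax s x)) has_real_derivative
      - (\<Sum>i<q. c (int i) * (defect x (int i))\<^sup>2)) (at 0)"
    unfolding act_def c_def
    using gap[OF xX] by (intro action_deriv[where p = p] xp) (metis diff_self less_irrefl)
  \<comment> \<open>The minimiser may satisfy some Birkhoff constraint with equality, so it is
    compared only with \<open>relax h x\<close> for \<open>h > 0\<close>, which stays in
    \<open>X\<close>.\<close>
  have "(\<Sum>i<q. c (int i) * (defect x (int i))\<^sup>2) \<le> 0"
  proof (rule ccontr)
    assume "\<not> ?thesis"
    then obtain e where e: "e > 0" "\<And>h. 0 < h \<Longrightarrow> h < e \<Longrightarrow> act (relax (0 + h) x) < act (relax 0 x)"
      using DERIV_neg_dec_right[OF der] by auto
    \<comment> \<open>Half of \<open>e\<close> keeps the step strictly inside the range of decrease;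
      the other bound keeps relaxation order preserving.\<close>
    define h where "h = min (e / 2) (1 / (2 * (g + K)))"
    have gK: "g + K > 0" using g_pos K_nonneg by simp
    have h: "0 < h" "h < e" using e gK by (auto simp: h_def min_def)
    have "h \<le> 1 / (2 * (g + K))" by (simp add: h_def)
    then have "h * (2 * (g + K)) \<le> 1" using gK by (simp add: field_simps)
    then have "birkhoff \<alpha> (relax h x)"
      using h \<alpha> xB by (intro relax_birkhoff) auto
    moreover have "relax h x (i + int q) = relax h x i + of_int p" for i
      by (simp add: relax_def xp per_defect)
    ultimately have "act x \<le> act (relax h x)" by (intro min) (simp add: X_def)
    moreover have "relax 0 x = x" by (simp add: relax_def fun_eq_iff)
    ultimately show False using e(2)[OF h] by simp
  qed
  moreover have nonneg: "0 \<le> c (int i) * (defect x (int i))\<^sup>2" for i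
    using c[of "int i"] by simp
  ultimately have "(\<Sum>i<q. c (int i) * (defect x (int i))\<^sup>2) = 0"
    by (intro antisym sum_nonneg) auto
  then have zero: "defect x (int i) = 0" if "i < q" for i
    using that c[of "int i"] nonneg by (subst (asm) sum_nonneg_eq_0_iff) (auto dest!: bspec[of _ _ i])
  have "defect x n = 0" for n
  proof -
    interpret d: periodic_fun_simple "defect x" "int q"
      by unfold_locales (rule per_defect)
    have "defect x n = defect x (n - of_int (n div int q) * int q)"
      by (rule d.minus_of_int[symmetric])
    also have "n - of_int (n div int q) * int q = int (nat (n mod int q))"
      using q by (simp add: minus_div_mult_eq_mod)
    also have "defect x \<dots> = 0"
      using q by (intro zero) (simp add: nat_less_iff)
    finally show ?thesis .
  qed
  with xB x show ?thesis by (intro that) (auto simp: X0_def)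
qed

section \<open>Arbitrary mean gap as a limit of rational ones\<close>

lemma defect_tendsto:
  assumes "\<And>i. (\<lambda>k. X k i) \<longlonglongrightarrow> x i" "\<And>i. x (i + 1) \<noteq> x i"
  shows "(\<lambda>k. defect (X k) n) \<longlonglongrightarrow> defect x n"
proof -
  have "(\<lambda>k. f (X k i)) \<longlonglongrightarrow> f (x i)" "(\<lambda>k. deriv f (X k i)) \<longlonglongrightarrow> deriv f (x i)" for i
    using continuous_on_tendsto_compose[OF f_cont[of UNIV] assms(1)[of i]]
      continuous_on_tendsto_compose[OF deriv_cont[of UNIV] assms(1)[of i]] by auto
  moreover have "x (n + 1) - x n \<noteq> 0" "x n - x (n - 1) \<noteq> 0"
    using assms(2)[of n] assms(2)[of "n - 1"] by auto
  ultimately show ?thesis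
    unfolding defect_def takeoff_def landing_def divided_difference_def
    by (intro tendsto_intros assms(1))
qed

text \<open>The 2 subtracted from \<alpha> pays for two losses of at most 1: the rational
  approximation lies below \<alpha>, and a Birkhoff gap may fall short of its mean.\<close>

lemma defect_zero_exists:
  assumes \<alpha>: "2 < \<alpha>" "4 * M / g \<le> \<alpha> - 2" "2 * M < g / 2 * (\<alpha> - 2)"
  obtains x where "\<And>n. \<alpha> - 2 \<le> x (n + 1) - x n" "\<And>n. defect x n = 0"
    "\<And>n. \<bar>x n - x 0 - of_int n * \<alpha>\<bar> \<le> 1"
proof -
  define q where "q k = Suc k" for k
  \<comment> \<open>Rational approximations from below with error at most \<open>1 / q k\<close>,
    hence never more than 1.\<close>
  define \<beta> where "\<beta> k = of_int \<lfloor>real (q k) * \<alpha>\<rfloor> / real (q k)" for k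
  have \<beta>le: "\<beta> k \<le> \<alpha>" and \<beta>ge: "\<alpha> - 1 / real (q k) \<le> \<beta> k" for k
  proof -
    have q: "real (q k) > 0" by (simp add: q_def)
    have "\<beta> k \<le> real (q k) * \<alpha> / real (q k)"
      unfolding \<beta>_def using q by (intro divide_right_mono) auto
    then show "\<beta> k \<le> \<alpha>" using q by simp
    have "(real (q k) * \<alpha> - 1) / real (q k) \<le> \<beta> k"
      unfolding \<beta>_def using q by (intro divide_right_mono) linarith+
    then show "\<alpha> - 1 / real (q k) \<le> \<beta> k" using q by (simp add: diff_divide_distrib)
  qed
  have \<beta>1: "\<alpha> - 1 \<le> \<beta> k" for k
  proof -
    have "1 / real (q k) \<le> 1" by (simp add: q_def)
    then show ?thesis using \<beta>ge[of k] by linarith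
  qed
  have \<beta>lim: "\<beta> \<longlonglongrightarrow> \<alpha>"
  proof (rule tendsto_sandwich)
    have "(\<lambda>k. \<alpha> - 1 / real (q k)) \<longlonglongrightarrow> \<alpha> - 0"
      unfolding q_def by (intro tendsto_intros lim_1_over_n[THEN LIMSEQ_Suc])
    then show "(\<lambda>k. \<alpha> - 1 / real (q k)) \<longlonglongrightarrow> \<alpha>" by simp
  qed (use \<beta>le \<beta>ge in auto)
  have "\<exists>x. birkhoff (\<beta> k) x \<and> (\<forall>n. defect x n = 0) \<and> 0 \<le> x 0 \<and> x 0 \<le> 1" for k
  proof (rule periodic_defect_zero)
    show "\<beta> k = of_int \<lfloor>real (q k) * \<alpha>\<rfloor> / real (q k)" by (rule \<beta>_def)
    have "g / 2 * (\<alpha> - 2) \<le> g / 2 * (\<beta> k - 1)"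
      using \<beta>1[of k] g_pos by (intro mult_left_mono) auto
    then show "2 * M < g / 2 * (\<beta> k - 1)" using \<alpha> by linarith
  qed (use \<alpha> \<beta>1[of k] in \<open>auto simp: q_def\<close>)
  then obtain X where X: "\<And>k. birkhoff (\<beta> k) (X k)" "\<And>k n. defect (X k) n = 0"
    "\<And>k. 0 \<le> X k 0" "\<And>k. X k 0 \<le> 1" by metis
  have near: "\<bar>X k n - X k 0 - of_int n * \<beta> k\<bar> \<le> 1" for k n
    using birkhoff_lower[OF X(1)[of k], of 0 n] birkhoff_upper[OF X(1)[of k], of 0 n] by simp
  \<comment> \<open>The box must not depend on \<open>k\<close>: replacing \<open>\<beta> k\<close>
    by \<alpha> costs at most \<open>\<bar>n\<bar>\<close>, and \<open>X k 0\<close> lies in the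
    unit interval.\<close>
  have box: "of_int n * \<alpha> - (\<bar>of_int n\<bar> + 1) \<le> X k n \<and> X k n \<le> of_int n * \<alpha> + (\<bar>of_int n\<bar> + 2)"
    for k n
  proof -
    have "\<bar>of_int n * (\<beta> k - \<alpha>)\<bar> \<le> \<bar>of_int n\<bar> * 1"
      unfolding abs_mult using \<beta>1[of k] \<beta>le[of k] by (intro mult_left_mono) auto
    then show ?thesis
      using near[of k n] X(3,4)[of k] unfolding right_diff_distrib by linarith
  qed
  have "seq_compact {x. \<forall>n. of_int n * \<alpha> - (\<bar>of_int n\<bar> + 1) \<le> x n \<and>
      x n \<le> of_int n * \<alpha> + (\<bar>of_int n\<bar> + 2)}"
    using compact_Collect_between[of "\<lambda>n. of_int n * \<alpha> - (\<bar>of_int n\<bar> + 1)"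
      "\<lambda>n. of_int n * \<alpha> + (\<bar>of_int n\<bar> + 2)"]
    by (simp add: compact_imp_seq_compact)
  then obtain x r where r: "strict_mono (r :: nat \<Rightarrow> nat)" and "(X \<circ> r) \<longlonglongrightarrow> x"
    using box by (elim seq_compactE[of _ X]) auto
  then have lim: "(\<lambda>k. X (r k) n) \<longlonglongrightarrow> x n" for n
    using continuous_on_tendsto_compose[OF continuous_on_coordinate[of UNIV n]]
    by (fastforce simp: o_def)
  have \<beta>r: "(\<lambda>k. \<beta> (r k)) \<longlonglongrightarrow> \<alpha>"
    using LIMSEQ_subseq_LIMSEQ[OF \<beta>lim r] by (simp add: o_def)
  show ?thesis
  proof
    show gap: "\<alpha> - 2 \<le> x (n + 1) - x n" for n
    proof (rule LIMSEQ_le_const[OF tendsto_diff[OF lim lim]])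
      show "\<exists>N. \<forall>k\<ge>N. \<alpha> - 2 \<le> X (r k) (n + 1) - X (r k) n"
      proof (intro exI allI impI)
        fix k
        show "\<alpha> - 2 \<le> X (r k) (n + 1) - X (r k) n"
          using birkhoff_gap[OF X(1)[of "r k"], of n] \<beta>1[of "r k"] by linarith
      qed
    qed
    \<comment> \<open>The gap bound survives the limit and keeps the denominators of the defect away
      from zero.\<close>
    have "x (i + 1) \<noteq> x i" for i using gap[of i] \<alpha> by auto
    then have "(\<lambda>k. defect (X (r k)) n) \<longlonglongrightarrow> defect x n" for n
      by (intro defect_tendsto lim)
    then show "defect x n = 0" for n
      using X(2) by (simp add: LIMSEQ_const_iff)
    have "(\<lambda>k. \<bar>X (r k) n - X (r k) 0 - of_int n * \<beta> (r k)\<bar>) \<longlonglongrightarrow> \<bar>x n - x 0 - of_int n * \<alpha>\<bar>" for n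
      by (intro tendsto_intros lim \<beta>r)
    then show "\<bar>x n - x 0 - of_int n * \<alpha>\<bar> \<le> 1" for n
      by (rule LIMSEQ_le_const2) (use near in auto)
  qed
qed

end

section \<open>Constants of the racket and orbits with prescribed mean gap\<close>

lemma racket_exists:
  assumes "g > 0" and C4: "C_k 4 f" and per: "\<And>x. f (x + 1) = f x"
  obtains M K where "racket g f M K"
proof -
  have "(deriv ^^ i) f differentiable_on UNIV" if "i < 4" for i
    using C4 that unfolding C_k_def by blast
  from this[of 0] this[of 1] this[of 2]
  have diff: "f differentiable_on UNIV" "deriv f differentiable_on UNIV"
    "deriv (deriv f) differentiable_on UNIV"
    by (simp_all add: numeral_2_eq_2)
  then have D: "(f has_real_derivative deriv f x) (at x)"
    and D2: "(deriv f has_real_derivative deriv (deriv f) x) (at x)" for x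
    by (simp_all add: differentiable_on_def DERIV_deriv_iff_real_differentiable)
  note per1 = deriv_periodic[OF D per]
  note per2 = deriv_periodic[OF D2 per1]
  obtain M where M: "\<And>x. \<bar>deriv f x\<bar> \<le> M"
    using continuous_periodic_bounded[OF differentiable_imp_continuous_on[OF diff(2)] per1] by blast
  obtain K where K: "\<And>x. \<bar>deriv (deriv f) x\<bar> \<le> K"
    using continuous_periodic_bounded[OF differentiable_imp_continuous_on[OF diff(3)] per2] by blast
  have "\<bar>deriv f x - deriv f y\<bar> \<le> K * \<bar>x - y\<bar>" for x y
    using field_differentiable_bound[of UNIV "deriv f" "deriv (deriv f)" K x y] D2 K by auto
  then have "racket g f M K"
    using assms D M by unfold_locales
  then show ?thesis by (rule that)
qed

theorem theorem1:
  fixes g :: real and f :: "real \<Rightarrow> real" and wbar :: real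
  assumes "g > 0"
    and "C_k 4 f"
    and "\<And>x. f (x + 1) = f x"
    and "admissible_threshold g f wbar"
  shows "\<exists>\<alpha>\<^sub>0::real. \<forall>\<alpha>>\<alpha>\<^sub>0. \<exists>t w :: int \<Rightarrow> real.
           bouncing_ball_orbit g f wbar t w \<and>
           (\<lambda>n. 1 / real n * (\<Sum>k<n. t (int k + 1) - t (int k))) \<longlonglongrightarrow> \<alpha>"
proof -
  obtain M K where "racket g f M K"
    using racket_exists assms(1-3) by blast
  then interpret racket g f M K .
  have wbar: "wbar > 0" using assms(4) by (simp add: admissible_threshold_def)
  \<comment> \<open>Chosen so that \<open>\<alpha> > \<alpha>\<^sub>0\<close> is equivalent to
    \<open>g / 2 * (\<alpha> - 2) - 2 * M > wbar\<close>, the velocity bound for gaps of at least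
    \<open>\<alpha> - 2\<close>.\<close>
  define \<alpha>\<^sub>0 where "\<alpha>\<^sub>0 = 2 + 4 * M / g + 2 * wbar / g"
  show ?thesis
  proof (intro exI[of _ \<alpha>\<^sub>0] allI impI)
    fix \<alpha> assume \<alpha>: "\<alpha> > \<alpha>\<^sub>0"
    have ge: "4 * M / g \<ge> 0" "2 * wbar / g > 0" using M_nonneg g_pos wbar by auto
    have big: "g / 2 * (\<alpha> - 2) - 2 * M > wbar"
      using \<alpha> g_pos by (simp add: \<alpha>\<^sub>0_def field_simps)
    obtain x where x: "\<And>n. \<alpha> - 2 \<le> x (n + 1) - x n" "\<And>n. defect x n = 0"
      "\<And>n. \<bar>x n - x 0 - of_int n * \<alpha>\<bar> \<le> 1"
    proof (rule defect_zero_exists)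
      show "2 < \<alpha>" "4 * M / g \<le> \<alpha> - 2" "2 * M < g / 2 * (\<alpha> - 2)"
        using \<alpha> ge big wbar unfolding \<alpha>\<^sub>0_def by linarith+
    qed (rule that)
    have orbit: "bouncing_ball_orbit g f wbar x (\<lambda>n. takeoff (x n) (x (n + 1)))"
      using \<alpha> ge by (intro orbit_of_defect_zero[OF assms(4) x(1) _ big x(2)])
        (auto simp: \<alpha>\<^sub>0_def)
    \<comment> \<open>The telescoped sum differs from \<open>n * \<alpha>\<close> by at most 1, so
      the mean has error at most \<open>1 / n\<close>.\<close>
    have "(\<lambda>n. 1 / real n * (x (int n) - x 0)) \<longlonglongrightarrow> \<alpha>"
    proof (rule Lim_null[THEN iffD2], rule Lim_null_comparison)
      show "\<forall>\<^sub>F n in sequentially. norm (1 / real n * (x (int n) - x 0) - \<alpha>) \<le> 1 / real n"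
        using eventually_gt_at_top[of 0]
      proof eventually_elim
        case (elim n)
        have "1 / real n * (x (int n) - x 0) - \<alpha> = (x (int n) - x 0 - of_int (int n) * \<alpha>) / real n"
          using elim by (simp add: field_simps)
        then show ?case
          using x(3)[of "int n"] elim by (simp add: divide_right_mono)
      qed
    qed (rule lim_1_over_n)
    moreover have "(\<Sum>k<n. x (int k + 1) - x (int k)) = x (int n) - x 0" for n
      using sum_lessThan_telescope[of "\<lambda>k. x (int k)" n] by (simp add: add.commute)
    ultimately show "\<exists>t w. bouncing_ball_orbit g f wbar t w \<and>
        (\<lambda>n. 1 / real n * (\<Sum>k<n. t (int k + 1) - t (int k))) \<longlonglongrightarrow> \<alpha>"
      using orbit by auto
  qed
qed

end
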